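(* Let $\mathcal U$ be a local chart of a two-dimensional Riemannian manifold (identified with an open subset of $\mathbb R^2$), and let $X=f(x)$ be the vector field on $\mathcal U$ defined by a nowhere vanishing continuous function $f:\mathcal U\to\mathbb R^2$. Suppose $f$ has a modulus of continuity $\omega$ satisfying $$\lim_{\epsilon\to 0}\ \frac1\epsilon\int_0^\epsilon\omega(t)\,dt\cdot\exp\left(\frac1{\epsilon^2}\int_0^\epsilon\omega(t)\,dt\right)=0 .$$ Then $X$ has a unique local integral curve through every point of $\mathcal U$.
   Context: A modulus of continuity of a continuous function $f$ on $\mathcal U$ is a continuous function $\omega:[0,\infty)\to[0,\infty)$ with $\omega(t)\to0$ as $t\to0$ and $|f(x)-f(y)|\le\omega(|x-y|)$ for all $x,y\in\mathcal U$. Uniqueness of the local integral curve through a point means that any two integral curves of $X$ with the same initial condition coincide near that initial point. *)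

theory Defs
  imports "HOL-Analysis.Analysis"
begin

definition modulus_of_continuity ::
  "('a::metric_space \<Rightarrow> 'b::metric_space) \<Rightarrow> 'a set \<Rightarrow> (real \<Rightarrow> real) \<Rightarrow> bool"
where
  "modulus_of_continuity f U \<omega> \<longleftrightarrow>
     continuous_on {0..} \<omega> \<and>
     (\<forall>t\<ge>0. 0 \<le> \<omega> t) \<and>
     (\<omega> \<longlongrightarrow> 0) (at_right 0) \<and>
     (\<forall>x\<in>U. \<forall>y\<in>U. dist (f x) (f y) \<le> \<omega> (dist x y))"

definition integral_curve ::
  "('a::real_normed_vector \<Rightarrow> 'a) \<Rightarrow> 'a set \<Rightarrow> real set \<Rightarrow> (real \<Rightarrow> 'a) \<Rightarrow> bool"
where
  "integral_curve f U I \<gamma> \<longleftrightarrow>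
     open I \<and> is_interval I \<and> \<gamma> ` I \<subseteq> U \<and>
     (\<forall>t\<in>I. (\<gamma> has_vector_derivative f (\<gamma> t)) (at t))"

definition integral_curve_through ::
  "('a::real_normed_vector \<Rightarrow> 'a) \<Rightarrow> 'a set \<Rightarrow> real \<Rightarrow> 'a \<Rightarrow> real set \<Rightarrow> (real \<Rightarrow> 'a) \<Rightarrow> bool"
where
  "integral_curve_through f U t0 p I \<gamma> \<longleftrightarrow>
     integral_curve f U I \<gamma> \<and> t0 \<in> I \<and> \<gamma> t0 = p"

text \<open>Uniqueness is that of germs: two curves with the same initial condition need only
  agree on some neighbourhood of the initial time, which may depend on the two curves.\<close>

definition unique_local_integral_curve ::
  "('a::real_normed_vector \<Rightarrow> 'a) \<Rightarrow> 'a set \<Rightarrow> 'a \<Rightarrow> bool"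
where
  "unique_local_integral_curve f U p \<longleftrightarrow>
     (\<forall>t0.
        (\<exists>I \<gamma>. integral_curve_through f U t0 p I \<gamma>) \<and>
        (\<forall>I\<^sub>1 \<gamma>\<^sub>1 I\<^sub>2 \<gamma>\<^sub>2.
           integral_curve_through f U t0 p I\<^sub>1 \<gamma>\<^sub>1 \<longrightarrow>
           integral_curve_through f U t0 p I\<^sub>2 \<gamma>\<^sub>2 \<longrightarrow>
           (\<exists>\<delta>>0. \<forall>t\<in>I\<^sub>1 \<inter> I\<^sub>2. \<bar>t - t0\<bar> < \<delta> \<longrightarrow> \<gamma>\<^sub>1 t = \<gamma>\<^sub>2 t)))"

end

theory Submission
  imports Defs "HOL-Complex_Analysis.Great_Picard"
begin

text \<open>
  The integral condition on \<open>\<omega>\<close> implies Osgood's condition, and then Osgood's classical argument gives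
  uniqueness.

  Let \<open>J \<epsilon>\<close> be the integral of \<open>\<omega>\<close> from \<open>0\<close> to \<open>\<epsilon>\<close>. Since \<open>(J \<epsilon> / \<epsilon>) exp (J \<epsilon> / \<epsilon>\<^sup>2)\<close> is eventually
  less than \<open>1\<close>, the quotient \<open>J \<epsilon> / \<epsilon>\<^sup>2\<close> is at most \<open>1 + ln (1 / \<epsilon>)\<close>
  (\<open>integral_le_of_mean_mult_exp\<close>). So on the dyadic interval between \<open>(1/2)^(k+1)\<close> and \<open>(1/2)^k\<close> the
  mean of \<open>\<omega>\<close> is at most of order \<open>k (1/2)^k\<close>. By the Cauchy--Schwarz inequality the integral of
  \<open>1 / \<phi>\<close> over this interval, where \<open>\<phi> r = \<omega> r + r\<close>, is then at least a constant times \<open>1 / k\<close>, and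
  the harmonic series diverges. Hence the integral of \<open>1 / \<phi>\<close> diverges at \<open>0\<close>
  (\<open>Osgood_of_mean_mult_exp\<close>).

  The distance \<open>u\<close> of two integral curves through the same point satisfies \<open>u' \<le> \<phi> u\<close> where it is
  positive. To climb from \<open>r\<close> to \<open>c\<close> it needs at least the time given by the integral of \<open>1 / \<phi>\<close> from
  \<open>r\<close> to \<open>c\<close>, which tends to infinity as \<open>r\<close> tends to \<open>0\<close>; so \<open>u\<close> never leaves \<open>0\<close>
  (\<open>Osgood_zero\<close>, \<open>integral_curves_agree_of_Osgood\<close>). In particular the curves agree on the whole of
  their common interval of definition.

  Existence is Peano's theorem (\<open>Peano_local_existence\<close>), proved by compactness: solutions of integral
  equations with a small delay exist by iteration, and a subsequence converges as the delay tends
  to \<open>0\<close>.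
\<close>

section \<open>Existence of integral curves\<close>

lemma integral_upto_Lipschitz:
  fixes g :: "real \<Rightarrow> 'a::euclidean_space"
  assumes cont: "continuous_on UNIV g" and bound: "\<And>s. norm (g s) \<le> M"
  shows "norm (integral {0..t} g - integral {0..s} g) \<le> M * \<bar>t - s\<bar>"
proof -
  have M: "0 \<le> M"
    using norm_ge_zero[of "g 0"] bound[of 0] by linarith
  have *: "norm (integral {0..t} g - integral {0..s} g) \<le> M * \<bar>t - s\<bar>" if "s \<le> t" for s t
  proof (cases "0 \<le> s")
    case True
    have int: "g integrable_on {a..c}" for a c
      by (rule integrable_continuous_real) (rule continuous_on_subset[OF cont], simp)
    have "integral {0..s} g + integral {s..t} g = integral {0..t} g"
      by (rule Henstock_Kurzweil_Integration.integral_combine) (use True that int in auto)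
    then have "integral {0..t} g - integral {0..s} g = integral {s..t} g"
      by (simp add: algebra_simps)
    moreover have "norm (integral {s..t} g) \<le> M * (t - s)"
      by (rule integral_bound[OF that continuous_on_subset[OF cont]]) (use bound in auto)
    ultimately show ?thesis using that by simp
  next
    case False
    then have s0: "integral {0..s} g = 0" by simp
    show ?thesis
    proof (cases "0 \<le> t")
      case True
      have "norm (integral {0..t} g) \<le> M * (t - 0)"
        by (rule integral_bound[OF True continuous_on_subset[OF cont]]) (use bound in auto)
      also have "\<dots> \<le> M * \<bar>t - s\<bar>"
        using M False True by (intro mult_left_mono) auto
      finally show ?thesis using s0 by simp
    next
      case False
      then show ?thesis using s0 M by simp
    qed
  qed
  show ?thesis
    using *[of s t] *[of t s] by (cases "s \<le> t") (auto simp: norm_minus_commute abs_minus_commute)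
qed

text \<open>
  With the delay \<open>h\<close>, the right-hand side at time \<open>t\<close> involves \<open>x\<close> only up to time \<open>t - h\<close>, so the
  equation determines \<open>x\<close> step by step. Iterating the right-hand side \<open>T\<close> from the constant \<open>p\<close>,
  the \<open>n\<close>-th iterate is final up to time \<open>n h\<close>. For \<open>t < h\<close> the integral is over an
  empty interval and \<open>x t = p\<close>.
\<close>

lemma delayed_integral_equation:
  fixes F :: "'a::euclidean_space \<Rightarrow> 'a" and h b :: real
  assumes cont: "continuous_on UNIV F" and bound: "\<And>y. norm (F y) \<le> M" and h: "0 < h"
  obtains x where "continuous_on UNIV x"
    "\<And>t. t \<le> b \<Longrightarrow> x t = p + integral {0..t - h} (\<lambda>s. F (x s))"
proof -
  define T where "T = (\<lambda>x t. p + integral {0..t - h} (\<lambda>s. F (x s)))"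
  define X where "X = (\<lambda>n. (T ^^ n) (\<lambda>_. p))"
  have XS: "X (Suc n) = T (X n)" for n by (simp add: X_def)
  have contX: "continuous_on UNIV (X n)" for n
  proof (induction n)
    case 0
    show ?case by (simp add: X_def)
  next
    case (Suc n)
    let ?g = "\<lambda>s. F (X n s)"
    have g: "continuous_on UNIV ?g"
      by (rule continuous_on_compose2[OF cont Suc]) auto
    have "M-lipschitz_on UNIV (\<lambda>t. integral {0..t - h} ?g)"
    proof (rule lipschitz_onI)
      show "dist (integral {0..t - h} ?g) (integral {0..s - h} ?g) \<le> M * dist t s" for t s
        using integral_upto_Lipschitz[OF g bound, of "t - h" "s - h"] by (simp add: dist_norm)
      show "0 \<le> M" using order_trans[OF norm_ge_zero bound] .
    qed
    then have "continuous_on UNIV (\<lambda>t. integral {0..t - h} ?g)"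
      by (rule lipschitz_on_continuous_on)
    then show ?case unfolding XS T_def by (intro continuous_intros)
  qed
  have step: "X (Suc n) t = X n t" if "t \<le> real n * h" for n t
    using that
  proof (induction n arbitrary: t)
    case 0
    have "integral {0..t - h} (\<lambda>s. F p) = 0" using 0 h by simp
    then show ?case by (simp add: X_def T_def)
  next
    case (Suc n)
    have "integral {0..t - h} (\<lambda>s. F (X (Suc n) s)) = integral {0..t - h} (\<lambda>s. F (X n s))"
    proof (rule Henstock_Kurzweil_Integration.integral_cong)
      fix s assume "s \<in> {0..t - h}"
      then have "s \<le> real n * h" using Suc.prems by (auto simp: algebra_simps)
      then show "F (X (Suc n) s) = F (X n s)" by (simp add: Suc.IH)
    qed
    then show ?case by (simp add: XS[of "Suc n"] XS[of n] T_def del: funpow.simps)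
  qed
  obtain N :: nat where N: "b < real N * h"
    using reals_Archimedean3[OF h] by blast
  show thesis
  proof
    show "continuous_on UNIV (X N)" by (rule contX)
    show "X N t = p + integral {0..t - h} (\<lambda>s. F (X N s))" if "t \<le> b" for t
      using step[of t N] that N by (simp add: XS T_def)
  qed
qed

text \<open>
  Tonelli's proof of Peano's theorem: the solutions of the delayed equation with delay tending to \<open>0\<close>
  are \<open>M\<close>-Lipschitz, so a subsequence converges by the theorem of Arzela and Ascoli. A delay \<open>h\<close>
  changes the right-hand side by at most \<open>M h\<close>, so the limit solves the integral equation without
  delay.
\<close>

lemma Peano_forward:
  fixes F :: "'a::euclidean_space \<Rightarrow> 'a"
  assumes cont: "continuous_on UNIV F" and bound: "\<And>y. norm (F y) \<le> M"
  obtains x where "x 0 = p"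
    "\<And>t. t \<in> {0..b} \<Longrightarrow> (x has_vector_derivative F (x t)) (at t within {0..b})"
    "\<And>t. t \<in> {0..b} \<Longrightarrow> norm (x t - p) \<le> M * t"
proof (cases "0 \<le> b")
  case False
  then show thesis using that[of "\<lambda>_. p"] by auto
next
  case b: True
  have M: "0 \<le> M" using order_trans[OF norm_ge_zero bound] .
  define h where "h n = inverse (real (Suc n))" for n :: nat
  have h: "0 < h n" for n by (simp add: h_def)
  have "\<exists>x. continuous_on UNIV x \<and> (\<forall>t\<le>b. x t = p + integral {0..t - h n} (\<lambda>s. F (x s)))" for n
    using delayed_integral_equation[OF cont bound h, of b p] by metis
  then obtain X where contX: "\<And>n. continuous_on UNIV (X n)"
    and X: "\<And>n t. t \<le> b \<Longrightarrow> X n t = p + integral {0..t - h n} (\<lambda>s. F (X n s))"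
    by metis
  have contFX: "continuous_on UNIV (\<lambda>s. F (X n s))" for n
    by (rule continuous_on_compose2[OF cont contX]) auto
  have lip: "norm (X n t - X n s) \<le> M * \<bar>t - s\<bar>" if "t \<le> b" "s \<le> b" for n t s
    using integral_upto_Lipschitz[OF contFX[of n], of M "t - h n" "s - h n"] that bound by (simp add: X)
  have Xp: "norm (X n t - p) \<le> M * t" if "t \<in> {0..b}" for n t
  proof -
    have "X n 0 = p" using X[OF b] h[of n] b by (simp add: X)
    then show ?thesis using lip[of t 0 n] that by auto
  qed
  have bnd: "norm (X n t) \<le> norm p + M * b" if "t \<in> {0..b}" for n t
  proof -
    have "norm (X n t) \<le> norm p + norm (X n t - p)" by (rule norm_triangle_sub)
    moreover have "M * t \<le> M * b" using that M by (intro mult_left_mono) auto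
    ultimately show ?thesis using Xp[OF that, of n] by linarith
  qed
  obtain g k where contg: "continuous_on {0..b} g" and k: "strict_mono (k :: nat \<Rightarrow> nat)"
    and unif: "\<And>e. 0 < e \<Longrightarrow> \<exists>N. \<forall>n x. n \<ge> N \<and> x \<in> {0..b} \<longrightarrow> norm (X (k n) x - g x) < e"
  proof (rule Arzela_Ascoli[of "{0..b}" X "norm p + M * b"])
    fix x e :: real assume xe: "x \<in> {0..b}" "0 < e"
    show "\<exists>d>0. \<forall>n y. y \<in> {0..b} \<and> norm (x - y) < d \<longrightarrow> norm (X n x - X n y) < e"
    proof (intro exI[of _ "e / (M + 1)"] conjI allI impI)
      show "0 < e / (M + 1)" using xe M by simp
      fix n y assume y: "y \<in> {0..b} \<and> norm (x - y) < e / (M + 1)"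
      have "norm (X n x - X n y) \<le> M * \<bar>x - y\<bar>" using lip xe y by auto
      also have "\<dots> \<le> (M + 1) * \<bar>x - y\<bar>" by (simp add: algebra_simps)
      also have "\<dots> < e" using y M by (simp add: field_simps)
      finally show "norm (X n x - X n y) < e" .
    qed
  qed (use bnd in auto)
  have lim: "(\<lambda>n. X (k n) t) \<longlonglongrightarrow> g t" if "t \<in> {0..b}" for t
    unfolding LIMSEQ_iff using unif that by meson
  have contFg: "continuous_on {0..b} (\<lambda>s. F (g s))"
    by (rule continuous_on_compose2[OF cont contg]) auto
  have g_eq: "g t = p + integral {0..t} (\<lambda>s. F (g s))" if t: "t \<in> {0..b}" for t
  proof -
    let ?I = "\<lambda>n. integral {0..t} (\<lambda>s. F (X (k n) s))"
    have I: "?I \<longlonglongrightarrow> integral {0..t} (\<lambda>s. F (g s))"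
    proof (rule dominated_convergence(2))
      show "(\<lambda>s. F (X (k n) s)) integrable_on {0..t}" for n
        by (rule integrable_continuous_real) (rule continuous_on_subset[OF contFX], simp)
      show "(\<lambda>_. M) integrable_on {0..t}" by (rule integrable_const_ivl)
      show "norm (F (X (k n) s)) \<le> M" for n s by (rule bound)
      show "(\<lambda>n. F (X (k n) s)) \<longlonglongrightarrow> F (g s)" if "s \<in> {0..t}" for s
        using that t lim[of s] cont
        by (intro isCont_tendsto_compose[where g = F])
           (auto simp: continuous_on_eq_continuous_at)
    qed
    have "(\<lambda>n. X (k n) t - (p + ?I n)) \<longlonglongrightarrow> 0"
    proof (rule Lim_null_comparison)
      show "\<forall>\<^sub>F n in sequentially. norm (X (k n) t - (p + ?I n)) \<le> M * h (k n)"
      proof (rule always_eventually, rule allI)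
        fix n
        show "norm (X (k n) t - (p + ?I n)) \<le> M * h (k n)"
          using integral_upto_Lipschitz[OF contFX[of "k n"], of M "t - h (k n)" t] bound t h[of "k n"]
          by (simp add: X)
      qed
      have "h \<longlonglongrightarrow> 0" unfolding h_def by (rule LIMSEQ_inverse_real_of_nat)
      then have "(\<lambda>n. h (k n)) \<longlonglongrightarrow> 0"
        using LIMSEQ_subseq_LIMSEQ[OF _ k] by (auto simp: o_def)
      then show "(\<lambda>n. M * h (k n)) \<longlonglongrightarrow> 0"
        by (rule tendsto_mult_right_zero)
    qed
    moreover have "(\<lambda>n. X (k n) t - (p + ?I n)) \<longlonglongrightarrow> g t - (p + integral {0..t} (\<lambda>s. F (g s)))"
      by (intro tendsto_intros lim I t)
    ultimately have "g t - (p + integral {0..t} (\<lambda>s. F (g s))) = 0"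
      by (rule LIMSEQ_unique[symmetric])
    then show ?thesis by simp
  qed
  show thesis
  proof (rule that[of g])
    show "g 0 = p" using g_eq[of 0] b by simp
    show "(g has_vector_derivative F (g t)) (at t within {0..b})" if t: "t \<in> {0..b}" for t
    proof (rule has_vector_derivative_transform[OF t g_eq])
      show "((\<lambda>t. p + integral {0..t} (\<lambda>s. F (g s))) has_vector_derivative F (g t)) (at t within {0..b})"
        using integral_has_vector_derivative[OF contFg t]
        by (auto intro!: derivative_eq_intros)
    qed
    show "norm (g t - p) \<le> M * t" if t: "t \<in> {0..b}" for t
    proof (rule LIMSEQ_le_const2)
      show "(\<lambda>n. norm (X (k n) t - p)) \<longlonglongrightarrow> norm (g t - p)"
        by (intro tendsto_intros lim t)
    qed (use Xp t in blast)
  qed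
qed

text \<open>
  Composing \<open>f\<close> with the projection onto a closed ball \<open>K\<close> of radius \<open>r\<close> around \<open>p\<close> gives a bounded
  continuous field on the whole space. At speed at most \<open>M\<close>, solutions do not leave \<open>K\<close> before time
  \<open>b = r / M\<close>, and on \<open>K\<close> nothing was changed. The past of the curve is a forward solution for
  the reversed field, and the two halves fit together at time \<open>0\<close> as both have
  velocity \<open>f p\<close> there.
\<close>

lemma Peano_local_existence:
  fixes f :: "'a::euclidean_space \<Rightarrow> 'a"
  assumes U: "open U" and cont: "continuous_on U f" and p: "p \<in> U"
  shows "\<exists>I \<gamma>. integral_curve_through f U t0 p I \<gamma>"
proof -
  obtain r where r: "0 < r" "cball p r \<subseteq> U"
    using U p open_contains_cball by blast
  define K where "K = cball p r"
  define F where "F y = f (closest_point K y)" for y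
  have K: "convex K" "closed K" "K \<noteq> {}" "compact K" using r by (auto simp: K_def)
  have contK: "continuous_on K f" using cont r continuous_on_subset K_def by blast
  have inK: "closest_point K y \<in> K" for y using K closest_point_in_set by blast
  have FK: "F y = f y" if "y \<in> K" for y using that by (simp add: F_def closest_point_self)
  have contF: "continuous_on UNIV F"
    unfolding F_def
    by (rule continuous_on_compose2[OF contK continuous_on_closest_point]) (use K inK in auto)
  obtain M where M: "0 < M" "\<And>y. y \<in> K \<Longrightarrow> norm (f y) \<le> M"
    using compact_imp_bounded[OF compact_continuous_image[OF contK K(4)]]
    unfolding bounded_pos by auto
  have bF: "norm (F y) \<le> M" "norm (- F y) \<le> M" for y using M(2) inK by (auto simp: F_def)
  define b where "b = r / M"
  have b: "0 < b" using r M by (simp add: b_def)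
  obtain x where x: "x 0 = p"
    "\<And>t. t \<in> {0..b} \<Longrightarrow> (x has_vector_derivative F (x t)) (at t within {0..b})"
    "\<And>t. t \<in> {0..b} \<Longrightarrow> norm (x t - p) \<le> M * t"
    using Peano_forward[OF contF bF(1)] by blast
  have contmF: "continuous_on UNIV (\<lambda>y. - F y)" by (intro continuous_intros contF)
  obtain y where y: "y 0 = p"
    "\<And>t. t \<in> {0..b} \<Longrightarrow> (y has_vector_derivative - F (y t)) (at t within {0..b})"
    "\<And>t. t \<in> {0..b} \<Longrightarrow> norm (y t - p) \<le> M * t"
    using Peano_forward[OF contmF bF(2)] by blast
  define z where "z t = (if t \<in> {0..b} then x t else y (- t))" for t
  have inb: "M * t \<le> r" if "t \<le> b" for t
    using that M by (simp add: b_def field_simps)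
  have xK: "x t \<in> K" "y t \<in> K" if "t \<in> {0..b}" for t
    using x(3)[OF that] y(3)[OF that] inb[of t] that
    by (auto simp: K_def dist_norm norm_minus_commute)
  have zK: "z t \<in> K" if "t \<in> {-b..b}" for t
    using that xK(1)[of t] xK(2)[of "- t"] by (auto simp: z_def)
  have dy: "((\<lambda>t. y (- t)) has_vector_derivative F (y (- t))) (at t within {-b..0})"
    if t: "t \<in> {-b..0}" for t
  proof -
    have "(y has_vector_derivative - F (y (- t))) (at (- t) within uminus ` {-b..0})"
      using y(2)[of "- t"] t by simp
    moreover have "(uminus has_vector_derivative (-1::real)) (at t within {-b..0})"
      by (auto intro!: derivative_eq_intros)
    ultimately show ?thesis
      using vector_diff_chain_within[of uminus "-1" t "{-b..0}" y "- F (y (- t))"] by (simp add: o_def)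
  qed
  have dz: "(z has_vector_derivative F (z t)) (at t within {-b..b})" if t: "t \<in> {-b..b}" for t
  proof -
    have Un: "{-b..b} = {0..b} \<union> {-b..0}" using b by auto
    have eq: "F (z t) = (if t \<in> {0..b} then F (x t) else F (y (- t)))" by (simp add: z_def)
    have cl: "{0..b} \<union> (closure {0..b} \<inter> closure {-b..0}) = {0..b}"
      "{-b..0} \<union> (closure {0..b} \<inter> closure {-b..0}) = {-b..0}" using b by auto
    show ?thesis
      unfolding eq unfolding z_def[abs_def]
    proof (rule has_vector_derivative_If_within_closures)
      show "t \<in> {0..b} \<union> {-b..0}" using t Un by simp
      show "x t = y (- t)" if "t \<in> closure {0..b}" "t \<in> closure {-b..0}"
      proof -
        have "t = 0" using that by auto
        then show ?thesis using x(1) y(1) by simp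
      qed
      then show "F (x t) = F (y (- t))" if "t \<in> closure {0..b}" "t \<in> closure {-b..0}"
        using that by simp
      show "(x has_vector_derivative F (x t))
          (at t within {0..b} \<union> (closure {0..b} \<inter> closure {-b..0}))"
        if "t \<in> {0..b} \<union> (closure {0..b} \<inter> closure {-b..0})"
        using that x(2) unfolding cl by blast
      show "((\<lambda>t. y (- t)) has_vector_derivative F (y (- t)))
          (at t within {-b..0} \<union> (closure {0..b} \<inter> closure {-b..0}))"
        if "t \<in> {-b..0} \<union> (closure {0..b} \<inter> closure {-b..0})"
        using that dy unfolding cl by blast
    qed (rule Un)
  qed
  define \<gamma> where "\<gamma> t = z (t - t0)" for t
  define I where "I = {t0 - b<..<t0 + b}"
  have "(\<gamma> has_vector_derivative f (\<gamma> t)) (at t)" if t: "t \<in> I" for t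
  proof -
    have t': "t - t0 \<in> {-b<..<b}" using t by (auto simp: I_def)
    have "(z has_vector_derivative F (z (t - t0))) (at (t - t0) within {-b<..<b})"
      by (rule has_vector_derivative_within_subset[OF dz]) (use t' in auto)
    then have "(z has_vector_derivative F (z (t - t0))) (at (t - t0))"
      using t' at_within_open[of "t - t0" "{-b<..<b}"] by simp
    moreover have "((\<lambda>t. t - t0) has_vector_derivative 1) (at t)"
      by (auto intro!: derivative_eq_intros)
    ultimately have "(\<gamma> has_vector_derivative F (z (t - t0))) (at t)"
      using vector_diff_chain_at[of "\<lambda>t. t - t0" 1 t z] by (simp add: o_def \<gamma>_def[abs_def])
    then show ?thesis using zK[of "t - t0"] t' by (simp add: \<gamma>_def FK)
  qed
  moreover have "\<gamma> ` I \<subseteq> U" using zK r by (fastforce simp: I_def \<gamma>_def K_def)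
  moreover have "\<gamma> t0 = p" using b x(1) by (simp add: \<gamma>_def z_def)
  moreover have "open I" "is_interval I" "t0 \<in> I" using b by (auto simp: I_def is_interval_oo)
  ultimately show ?thesis
    unfolding integral_curve_through_def integral_curve_def by blast
qed

section \<open>Osgood's uniqueness criterion\<close>

text \<open>
  This is the Cauchy--Schwarz inequality
  \<open>(b - a)\<^sup>2 \<le> (\<integral> \<phi>) (\<integral> 1 / \<phi>)\<close>. It turns an upper bound on the mean of \<open>\<phi>\<close> into a
  lower bound for Osgood's integral, whatever the pointwise behaviour of \<open>\<phi>\<close>. The proof integrates
  the tangent line inequality \<open>1 / x \<ge> 2 / c - x / c\<^sup>2\<close> at \<open>x = \<phi> t\<close>, with \<open>c\<close> the bound \<open>M / (b - a)\<close>
  for the mean of \<open>\<phi>\<close>.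
\<close>

lemma integral_mult_integral_inverse_ge:
  fixes \<phi> :: "real \<Rightarrow> real"
  assumes ab: "a < b" and cont: "continuous_on {a..b} \<phi>" and pos: "\<And>t. t \<in> {a..b} \<Longrightarrow> 0 < \<phi> t"
    and M: "integral {a..b} \<phi> \<le> M" "0 < M"
  shows "(b - a)\<^sup>2 / M \<le> integral {a..b} (\<lambda>t. 1 / \<phi> t)"
proof -
  define c where "c = M / (b - a)"
  have c: "0 < c" using ab M by (simp add: c_def)
  have int: "\<phi> integrable_on {a..b}" by (rule integrable_continuous_real[OF cont])
  have "2 / c - \<phi> t / c\<^sup>2 \<le> 1 / \<phi> t" if "t \<in> {a..b}" for t
  proof -
    have "0 \<le> (\<phi> t - c)\<^sup>2 / (c\<^sup>2 * \<phi> t)" using pos[OF that] by simp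
    also have "\<dots> = 1 / \<phi> t - (2 / c - \<phi> t / c\<^sup>2)"
      using pos[OF that] c by (simp add: field_simps power2_eq_square)
    finally show ?thesis by simp
  qed
  moreover have "\<phi> t \<noteq> 0" if "t \<in> {a..b}" for t using pos[OF that] by simp
  ultimately have "integral {a..b} (\<lambda>t. 2 / c - \<phi> t / c\<^sup>2) \<le> integral {a..b} (\<lambda>t. 1 / \<phi> t)"
    using c cont by (intro integral_le integrable_continuous_real continuous_intros) auto
  moreover have "integral {a..b} (\<lambda>t. 2 / c - \<phi> t / c\<^sup>2) = 2 * (b - a) / c - integral {a..b} \<phi> / c\<^sup>2"
    using integral_unique[OF has_integral_diff[OF has_integral_const_real[of "2 / c" a b]
          has_integral_divide[OF integrable_integral[OF int], of "c\<^sup>2"]]] ab by simp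
  moreover have "integral {a..b} \<phi> / c\<^sup>2 \<le> M / c\<^sup>2"
    using M by (intro divide_right_mono) auto
  moreover have "2 * (b - a) / c - M / c\<^sup>2 = (b - a)\<^sup>2 / M"
    using ab M by (simp add: c_def field_simps power2_eq_square)
  ultimately show ?thesis by linarith
qed

text \<open>
  The integral of \<open>1 / \<phi>\<close> from \<open>r\<close> to \<open>c\<close> is the time that the fastest solution of
  \<open>v' = \<phi> v\<close> takes to climb from \<open>r\<close> to \<open>c\<close>, and \<open>u\<close> climbs no faster. If \<open>u\<close> reached \<open>c > 0\<close>, it
  would have to climb to \<open>c\<close> from every small \<open>r\<close> within time \<open>b - a\<close>, whereas the climbing time is
  unbounded as \<open>r\<close> tends to \<open>0\<close>.
\<close>

lemma Osgood_zero:
  fixes u u' \<phi> :: "real \<Rightarrow> real"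
  assumes contu: "continuous_on {a..b} u" and u0: "u a = 0"
    and nonneg: "\<And>t. t \<in> {a..b} \<Longrightarrow> 0 \<le> u t"
    and deriv: "\<And>t. t \<in> {a..b} \<Longrightarrow> 0 < u t \<Longrightarrow> (u has_real_derivative u' t) (at t within {a..b})"
    and le: "\<And>t. t \<in> {a..b} \<Longrightarrow> 0 < u t \<Longrightarrow> u' t \<le> \<phi> (u t)"
    and cont\<phi>: "continuous_on {0<..} \<phi>" and pos: "\<And>r. 0 < r \<Longrightarrow> 0 < \<phi> r"
    and Osgood: "\<And>K c. 0 < c \<Longrightarrow> \<exists>r\<in>{0<..<c}. K < integral {r..c} (\<lambda>r. 1 / \<phi> r)"
    and t: "t \<in> {a..b}"
  shows "u t = 0"
proof (rule ccontr)
  assume "u t \<noteq> 0"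
  define c where "c = u t"
  have c: "0 < c" using nonneg[OF t] \<open>u t \<noteq> 0\<close> by (simp add: c_def)
  obtain r where r: "0 < r" "r < c" and big: "b - a < integral {r..c} (\<lambda>r. 1 / \<phi> r)"
    using Osgood[OF c, of "b - a"] by auto
  have at: "a < t" using t u0 \<open>u t \<noteq> 0\<close> by (cases "a = t") auto
  define S where "S = {s \<in> {a..t}. u s = r}"
  have contt: "continuous_on {a..t} u" using contu t continuous_on_subset by fastforce
  have "\<exists>s. a \<le> s \<and> s \<le> t \<and> u s = r"
    by (rule IVT') (use u0 r at contt in \<open>auto simp: c_def\<close>)
  then have "S \<noteq> {}" by (auto simp: S_def)
  moreover have "compact S"
    unfolding compact_eq_bounded_closed S_def
    using continuous_closed_preimage_constant[OF contt, of r]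
    by (auto intro: bounded_subset[of "{a..t}"])
  ultimately obtain s where s: "s \<in> S" "\<And>s'. s' \<in> S \<Longrightarrow> s' \<le> s"
    using compact_attains_sup by metis
  have us: "u s = r" and ats: "a \<le> s" "s < t" using s r by (auto simp: S_def c_def less_le)
  \<comment> \<open>After its last visit to the level \<open>r\<close>, the function stays above it, hence away from the
    singularity of \<open>1 / \<phi>\<close>.\<close>
  have above: "r \<le> u s'" if s': "s' \<in> {s..t}" for s'
  proof (rule ccontr)
    assume "\<not> r \<le> u s'"
    then have "\<exists>w. s' \<le> w \<and> w \<le> t \<and> u w = r"
      using r s' ats by (intro IVT' continuous_on_subset[OF contt]) (auto simp: c_def)
    then obtain w where w: "s' \<le> w" "w \<le> t" "u w = r" by blast
    then have "w \<le> s" using s' ats by (intro s(2)) (auto simp: S_def)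
    then have "s' = s" using w s' by auto
    then show False using \<open>\<not> r \<le> u s'\<close> us by simp
  qed
  \<comment> \<open>On the way to \<open>c\<close> the function may overshoot \<open>c\<close>, so the antiderivative of \<open>- 1 / \<phi>\<close> has to be
    defined up to the maximum \<open>B\<close>.\<close>
  obtain B where B: "\<And>s'. s' \<in> {s..t} \<Longrightarrow> u s' \<le> B"
    using continuous_attains_sup[of "{s..t}" u] continuous_on_subset[OF contt, of "{s..t}"] ats by fastforce
  have cB: "c \<le> B" using B[of t] ats by (simp add: c_def)
  have nz: "\<phi> r \<noteq> 0" if "0 < r" for r using pos[OF that] by simp
  have cont1: "continuous_on {r..B} (\<lambda>r. 1 / \<phi> r)"
    using nz r by (intro continuous_intros continuous_on_subset[OF cont\<phi>]) auto
  define H where "H r' = integral {r'..B} (\<lambda>r. 1 / \<phi> r)" for r'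
  \<comment> \<open>\<open>H (u s')\<close> decreases at most at unit speed.\<close>
  have dH: "((\<lambda>s'. s' + H (u s')) has_real_derivative 1 - u' s' / \<phi> (u s')) (at s' within {s..t})"
    if s': "s' \<in> {s..t}" for s'
  proof -
    have in_rB: "u s' \<in> {r..B}" "u ` {s..t} \<subseteq> {r..B}" using above B s' by auto
    have s'ab: "s' \<in> {a..b}" "{s..t} \<subseteq> {a..b}" "0 < u s'" using s' ats t above[OF s'] r by auto
    have "(H has_real_derivative - (1 / \<phi> (u s'))) (at (u s') within u ` {s..t})"
      unfolding H_def
      by (rule DERIV_subset[OF integral_has_real_derivative'[OF cont1 in_rB(1)] in_rB(2)])
    moreover have "(u has_real_derivative u' s') (at s' within {s..t})"
      by (rule DERIV_subset[OF deriv]) (use s'ab in auto)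
    ultimately have "((\<lambda>s'. H (u s')) has_real_derivative - (1 / \<phi> (u s')) * u' s') (at s' within {s..t})"
      by (rule DERIV_image_chain[unfolded o_def])
    then show ?thesis by (auto intro!: derivative_eq_intros)
  qed
  obtain w where w: "w \<in> {s<..<t}"
    and eq: "(t + H (u t)) - (s + H (u s)) = (1 - u' w / \<phi> (u w)) * (t - s)"
    using mvt_simple[OF ats(2), of "\<lambda>s'. s' + H (u s')" "\<lambda>s' h. (1 - u' s' / \<phi> (u s')) * h"] dH
    by (auto simp: has_field_derivative_def)
  have "0 < u w" "w \<in> {a..b}" using above[of w] w r ats t by auto
  then have "u' w / \<phi> (u w) \<le> 1" using le pos by simp
  then have "s + H (u s) \<le> t + H (u t)" using eq w by (smt (verit) mult_nonneg_nonneg greaterThanLessThan_iff)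
  moreover have "H r = integral {r..c} (\<lambda>r. 1 / \<phi> r) + H c"
    unfolding H_def
    by (rule Henstock_Kurzweil_Integration.integral_combine[symmetric])
       (use r cB integrable_continuous_real[OF cont1] in auto)
  ultimately show False using big us ats t by (auto simp: c_def)
qed

text \<open>
  The norm is differentiable away from the origin, and its derivative along a curve is at most the
  norm of the velocity, so the scalar criterion applies to the norm of \<open>w\<close>. This is why
  that criterion asks for a derivative only where \<open>u\<close> is positive.
\<close>

lemma Osgood_zero_vector:
  fixes w w' :: "real \<Rightarrow> 'a::real_inner" and \<phi> :: "real \<Rightarrow> real"
  assumes w0: "w a = 0"
    and deriv: "\<And>t. t \<in> {a..b} \<Longrightarrow> (w has_vector_derivative w' t) (at t within {a..b})"
    and le: "\<And>t. t \<in> {a..b} \<Longrightarrow> w t \<noteq> 0 \<Longrightarrow> norm (w' t) \<le> \<phi> (norm (w t))"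
    and \<phi>: "continuous_on {0<..} \<phi>" "\<And>r. 0 < r \<Longrightarrow> 0 < \<phi> r"
    and Osgood: "\<And>K c. 0 < c \<Longrightarrow> \<exists>r\<in>{0<..<c}. K < integral {r..c} (\<lambda>r. 1 / \<phi> r)"
    and t: "t \<in> {a..b}"
  shows "w t = 0"
proof -
  have "norm (w t) = 0"
  proof (rule Osgood_zero[where u = "\<lambda>t. norm (w t)" and u' = "\<lambda>t. w' t \<bullet> sgn (w t)"])
    show "continuous_on {a..b} (\<lambda>t. norm (w t))"
      unfolding continuous_on_eq_continuous_within
      by (intro ballI continuous_norm has_vector_derivative_continuous[OF deriv])
    show "((\<lambda>t. norm (w t)) has_real_derivative w' t \<bullet> sgn (w t)) (at t within {a..b})"
      if "t \<in> {a..b}" "0 < norm (w t)" for t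
    proof -
      have "((norm \<circ> w) has_derivative (\<lambda>h. h \<bullet> sgn (w t)) \<circ> (\<lambda>h. h *\<^sub>R w' t)) (at t within {a..b})"
        using that deriv[OF that(1)] unfolding has_vector_derivative_def
        by (intro diff_chain_within has_derivative_at_withinI[OF has_derivative_norm]) auto
      then show ?thesis by (simp add: has_field_derivative_def o_def mult_commute_abs)
    qed
    show "w' t \<bullet> sgn (w t) \<le> \<phi> (norm (w t))" if "t \<in> {a..b}" "0 < norm (w t)" for t
    proof -
      have "w' t \<bullet> sgn (w t) \<le> norm (w' t) * norm (sgn (w t))" by (rule norm_cauchy_schwarz)
      also have "\<dots> = norm (w' t)" using that by (simp add: norm_sgn)
      finally show ?thesis using le[of t] that by simp
    qed
  qed (use assms in auto)
  then show ?thesis by simp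
qed

text \<open>
  The difference of the two curves obeys \<open>norm (w' s) \<le> \<phi> (norm (w s))\<close> and starts at \<open>0\<close>. Times
  before \<open>t0\<close> are reached by reversing time, which is the role of the sign \<open>e\<close>.
\<close>

lemma integral_curves_agree_of_Osgood:
  fixes f :: "'a::real_inner \<Rightarrow> 'a" and \<phi> :: "real \<Rightarrow> real"
  assumes mod: "\<And>x y. x \<in> U \<Longrightarrow> y \<in> U \<Longrightarrow> x \<noteq> y \<Longrightarrow> dist (f x) (f y) \<le> \<phi> (dist x y)"
    and \<phi>: "continuous_on {0<..} \<phi>" "\<And>r. 0 < r \<Longrightarrow> 0 < \<phi> r"
    and Osgood: "\<And>K c. 0 < c \<Longrightarrow> \<exists>r\<in>{0<..<c}. K < integral {r..c} (\<lambda>r. 1 / \<phi> r)"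
    and c1: "integral_curve_through f U t0 p I1 \<gamma>1" and c2: "integral_curve_through f U t0 p I2 \<gamma>2"
    and t: "t \<in> I1 \<inter> I2"
  shows "\<gamma>1 t = \<gamma>2 t"
proof -
  define e :: real where "e = (if t0 \<le> t then 1 else -1)"
  have e: "e * e = 1" "\<bar>e\<bar> = 1" by (auto simp: e_def)
  define w where "w s = \<gamma>1 (t0 + e * s) - \<gamma>2 (t0 + e * s)" for s
  define w' where "w' s = e *\<^sub>R (f (\<gamma>1 (t0 + e * s)) - f (\<gamma>2 (t0 + e * s)))" for s
  have t0I: "t0 \<in> I1 \<inter> I2" and int: "is_interval (I1 \<inter> I2)"
    and p: "\<gamma>1 t0 = p" "\<gamma>2 t0 = p"
    and d: "\<And>t. t \<in> I1 \<inter> I2 \<Longrightarrow> (\<gamma>1 has_vector_derivative f (\<gamma>1 t)) (at t)"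
      "\<And>t. t \<in> I1 \<inter> I2 \<Longrightarrow> (\<gamma>2 has_vector_derivative f (\<gamma>2 t)) (at t)"
    and inU: "\<And>t. t \<in> I1 \<inter> I2 \<Longrightarrow> \<gamma>1 t \<in> U \<and> \<gamma>2 t \<in> U"
    using c1 c2 by (auto simp: integral_curve_through_def integral_curve_def is_interval_Int)
  have inI: "t0 + e * s \<in> I1 \<inter> I2" if s: "s \<in> {0..\<bar>t - t0\<bar>}" for s
  proof (cases "t0 \<le> t")
    case True
    show ?thesis using s True mem_is_interval_1_I[OF int t0I t] by (simp add: e_def)
  next
    case False
    show ?thesis using s False mem_is_interval_1_I[OF int t t0I] by (simp add: e_def)
  qed
  have "w \<bar>t - t0\<bar> = 0"
  proof (rule Osgood_zero_vector[where w = w and w' = w' and a = 0 and b = "\<bar>t - t0\<bar>"])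
    show "w 0 = 0" using p by (simp add: w_def)
    show "(w has_vector_derivative w' s) (at s within {0..\<bar>t - t0\<bar>})" if s: "s \<in> {0..\<bar>t - t0\<bar>}" for s
    proof -
      have l: "((\<lambda>s. t0 + e * s) has_vector_derivative e) (at s)"
        by (auto intro!: derivative_eq_intros)
      let ?\<tau> = "t0 + e * s"
      have "((\<lambda>s. \<gamma>1 (t0 + e * s)) has_vector_derivative e *\<^sub>R f (\<gamma>1 ?\<tau>)) (at s)"
        by (rule vector_diff_chain_at[OF l d(1)[OF inI[OF s]], unfolded o_def])
      moreover have "((\<lambda>s. \<gamma>2 (t0 + e * s)) has_vector_derivative e *\<^sub>R f (\<gamma>2 ?\<tau>)) (at s)"
        by (rule vector_diff_chain_at[OF l d(2)[OF inI[OF s]], unfolded o_def])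
      ultimately have "(w has_vector_derivative w' s) (at s)"
        unfolding w_def[abs_def] w'_def scaleR_diff_right by (rule has_vector_derivative_diff)
      then show ?thesis by (rule has_vector_derivative_at_within)
    qed
    show "norm (w' s) \<le> \<phi> (norm (w s))" if s: "s \<in> {0..\<bar>t - t0\<bar>}" "w s \<noteq> 0" for s
      using mod[of "\<gamma>1 (t0 + e * s)" "\<gamma>2 (t0 + e * s)"] inU[OF inI[OF s(1)]] s(2) e
      by (simp add: w_def w'_def dist_norm)
  qed (use \<phi> Osgood in auto)
  moreover have "t0 + e * \<bar>t - t0\<bar> = t" by (auto simp: e_def)
  ultimately show ?thesis by (simp add: w_def)
qed

section \<open>From the integral condition to Osgood's condition\<close>

text \<open>
  Write \<open>J = \<epsilon>\<^sup>2 A\<close>. The hypothesis reads \<open>\<epsilon> A exp A < 1\<close>, so either \<open>A \<le> 1\<close> or \<open>exp A < 1 / \<epsilon>\<close>. The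
  exponential thus limits \<open>A\<close> to logarithmic growth in \<open>1 / \<epsilon>\<close>.
\<close>

lemma integral_le_of_mean_mult_exp:
  fixes J \<epsilon> :: real
  assumes \<epsilon>: "0 < \<epsilon>" "\<epsilon> \<le> 1" and lt: "(1 / \<epsilon>) * J * exp ((1 / \<epsilon>\<^sup>2) * J) < 1"
  shows "J \<le> \<epsilon>\<^sup>2 * (1 + ln (1 / \<epsilon>))"
proof -
  define A where "A = J / \<epsilon>\<^sup>2"
  have J: "J = \<epsilon>\<^sup>2 * A" using \<epsilon> by (simp add: A_def)
  have "A \<le> 1 + ln (1 / \<epsilon>)"
  proof (cases "A \<le> 1")
    case True
    moreover have "0 \<le> ln (1 / \<epsilon>)" using \<epsilon> by simp
    ultimately show ?thesis by linarith
  next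
    case False
    have "\<epsilon> * exp A \<le> \<epsilon> * A * exp A" using False \<epsilon> by simp
    also have "\<dots> < 1" using lt \<epsilon> by (simp add: J power2_eq_square)
    finally have "exp A < 1 / \<epsilon>" using \<epsilon> by (simp add: field_simps)
    then have "A < ln (1 / \<epsilon>)" using \<epsilon> by (metis exp_gt_zero ln_exp ln_less_cancel_iff order_less_trans)
    then show ?thesis by simp
  qed
  then show ?thesis unfolding J by (intro mult_left_mono) auto
qed

text \<open>
  By the Cauchy--Schwarz bound, the dyadic block between \<open>(1/2)^(k+1)\<close> and \<open>(1/2)^k\<close> contributes at
  least \<open>1 / (4 (k + 2))\<close> to the integral of \<open>1 / \<phi>\<close>: the block has length \<open>(1/2)^(k+1)\<close>, and the
  square of this length is a quarter of the factor \<open>((1/2)^k)\<^sup>2\<close> in the growth bound. The harmonic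
  series diverges. Only the behaviour near \<open>0\<close> counts, so finitely many blocks may violate the bound.
\<close>

lemma Osgood_of_dyadic_growth:
  fixes \<phi> :: "real \<Rightarrow> real"
  assumes cont: "continuous_on {0..} \<phi>" and pos: "\<And>r. 0 < r \<Longrightarrow> 0 < \<phi> r" and \<phi>0: "0 \<le> \<phi> 0"
    and growth: "\<And>k. n0 \<le> k \<Longrightarrow> integral {0..(1/2)^k} \<phi> \<le> ((1/2)^k)\<^sup>2 * (real k + 2)"
    and c: "0 < c"
  shows "\<exists>r\<in>{0<..<c}. K < integral {r..c} (\<lambda>r. 1 / \<phi> r)"
proof -
  let ?e = "\<lambda>k::nat. (1/2::real)^k"
  let ?\<psi> = "\<lambda>r. 1 / \<phi> r"
  have nonneg: "0 \<le> \<phi> r" if "0 \<le> r" for r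
    using \<phi>0 less_imp_le[OF pos[of r]] that by (cases "r = 0") simp_all
  have nz: "\<phi> r \<noteq> 0" if "0 < r" for r using pos[OF that] by simp
  have cont1: "continuous_on {a..b} ?\<psi>" if "0 < a" for a b
    using that nz by (intro continuous_intros continuous_on_subset[OF cont]) auto
  have int: "?\<psi> integrable_on {a..b}" if "0 < a" for a b
    by (rule integrable_continuous_real[OF cont1[OF that]])
  have block: "1 / (4 * (real k + 2)) \<le> integral {?e (Suc k)..?e k} ?\<psi>" if k: "n0 \<le> k" for k
  proof -
    have ek: "0 < ?e (Suc k)" "?e (Suc k) < ?e k" by auto
    have "integral {?e (Suc k)..?e k} \<phi> \<le> integral {0..?e k} \<phi>"
    proof (rule integral_subset_le)
      show "\<phi> integrable_on {?e (Suc k)..?e k}" "\<phi> integrable_on {0..?e k}"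
        by (intro integrable_continuous_real continuous_on_subset[OF cont]; simp)+
      show "\<forall>t\<in>{0..?e k}. 0 \<le> \<phi> t" using nonneg by simp
    qed auto
    then have le: "integral {?e (Suc k)..?e k} \<phi> \<le> (?e k)\<^sup>2 * (real k + 2)"
      using growth[OF k] by linarith
    have "(?e k - ?e (Suc k))\<^sup>2 / ((?e k)\<^sup>2 * (real k + 2)) \<le> integral {?e (Suc k)..?e k} ?\<psi>"
    proof (rule integral_mult_integral_inverse_ge[OF ek(2) _ _ le])
      show "continuous_on {?e (Suc k)..?e k} \<phi>"
        using ek by (intro continuous_on_subset[OF cont]) auto
      show "0 < \<phi> t" if "t \<in> {?e (Suc k)..?e k}" for t
        using that less_le_trans[OF ek(1)] by (intro pos) (simp only: atLeastAtMost_iff)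
    qed auto
    moreover have "(?e k - ?e (Suc k))\<^sup>2 / ((?e k)\<^sup>2 * (real k + 2)) = 1 / (4 * (real k + 2))"
      by (simp add: field_simps power2_eq_square)
    ultimately show ?thesis by simp
  qed
  obtain n1 where "?e n1 < c" using real_arch_pow_inv[OF c, of "1/2"] by auto
  define m where "m = max n0 n1"
  have "?e m \<le> ?e n1" by (rule power_decreasing) (auto simp: m_def)
  then have em: "?e m < c" using \<open>?e n1 < c\<close> by linarith
  have blocks: "(\<Sum>i<n. 1 / (4 * (real (m + i) + 2))) \<le> integral {?e (m + n)..?e m} ?\<psi>" for n
  proof (induction n)
    case (Suc n)
    have "integral {?e (Suc (m + n))..?e (m + n)} ?\<psi> + integral {?e (m + n)..?e m} ?\<psi>
        = integral {?e (Suc (m + n))..?e m} ?\<psi>"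
      by (rule Henstock_Kurzweil_Integration.integral_combine)
         (use int in \<open>auto intro!: power_decreasing simp del: power_Suc\<close>)
    moreover have "n0 \<le> m + n" by (simp add: m_def)
    ultimately show ?case
      using Suc block[of "m + n"] unfolding sum.lessThan_Suc add_Suc_right by linarith
  qed simp
  have "\<not> summable (\<lambda>i. 1 / (4 * (real (m + i) + 2)))"
  proof
    assume "summable (\<lambda>i. 1 / (4 * (real (m + i) + 2)))"
    then have "summable (\<lambda>i. 4 * (1 / (4 * (real (m + i) + 2))))" by (rule summable_mult)
    moreover have "4 * (1 / (4 * (real (m + i) + 2))) = inverse (real (i + (m + 2)))" for i
      by (simp add: field_simps)
    ultimately have "summable (\<lambda>i. inverse (real (i + (m + 2))))" by (simp only:)
    then show False
      using not_summable_harmonic[where 'a = real]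
        summable_iff_shift[of "\<lambda>i. inverse (real i)" "m + 2"] by blast
  qed
  moreover have "0 \<le> 1 / (4 * (real (m + i) + 2))" for i by simp
  ultimately obtain n where n: "K < (\<Sum>i<n. 1 / (4 * (real (m + i) + 2)))"
    using summableI_nonneg_bounded[of "\<lambda>i. 1 / (4 * (real (m + i) + 2))" K] by (meson not_le)
  have "integral {?e (m + n)..?e m} ?\<psi> \<le> integral {?e (m + n)..c} ?\<psi>"
  proof (rule integral_subset_le)
    show "\<forall>t\<in>{?e (m + n)..c}. 0 \<le> ?\<psi> t"
    proof
      fix t assume "t \<in> {?e (m + n)..c}"
      moreover have "0 < ?e (m + n)" by simp
      ultimately have "0 < t" unfolding atLeastAtMost_iff by linarith
      then show "0 \<le> ?\<psi> t" using nonneg by simp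
    qed
  qed (use int em in auto)
  then have "K < integral {?e (m + n)..c} ?\<psi>" using n blocks[of n] by linarith
  moreover have "?e (m + n) \<le> ?e m" by (rule power_decreasing) auto
  then have "?e (m + n) \<in> {0<..<c}" using em by (simp del: power_decreasing_iff)
  ultimately show ?thesis by blast
qed

text \<open>
  The summand \<open>r\<close> makes the denominator positive also where \<open>\<omega>\<close> vanishes. It adds only \<open>\<epsilon>\<^sup>2 / 2\<close> to the
  integral up to \<open>\<epsilon>\<close>, which is harmless: at \<open>\<epsilon> = (1/2)^k\<close> the logarithmic bound is
  \<open>\<epsilon>\<^sup>2 (1 + k ln 2)\<close>, and the sum stays below \<open>\<epsilon>\<^sup>2 (k + 2)\<close>.
\<close>

lemma Osgood_of_mean_mult_exp:
  fixes \<omega> :: "real \<Rightarrow> real"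
  assumes cont: "continuous_on {0..} \<omega>" and nonneg: "\<And>t. 0 \<le> t \<Longrightarrow> 0 \<le> \<omega> t"
    and lim: "((\<lambda>\<epsilon>. (1 / \<epsilon>) * integral {0..\<epsilon>} \<omega> * exp ((1 / \<epsilon>\<^sup>2) * integral {0..\<epsilon>} \<omega>)) \<longlongrightarrow> 0)
           (at_right 0)"
    and c: "0 < c"
  shows "\<exists>r\<in>{0<..<c}. K < integral {r..c} (\<lambda>r. 1 / (\<omega> r + r))"
proof -
  have "\<forall>\<^sub>F \<epsilon> in at_right 0.
      (1 / \<epsilon>) * integral {0..\<epsilon>} \<omega> * exp ((1 / \<epsilon>\<^sup>2) * integral {0..\<epsilon>} \<omega>) < 1"
    by (rule order_tendstoD(2)[OF lim]) simp
  then obtain d where d: "0 < d" and small: "\<And>\<epsilon>. 0 < \<epsilon> \<Longrightarrow> \<epsilon> < d \<Longrightarrow>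
      (1 / \<epsilon>) * integral {0..\<epsilon>} \<omega> * exp ((1 / \<epsilon>\<^sup>2) * integral {0..\<epsilon>} \<omega>) < 1"
    by (auto simp: eventually_at_right_field)
  obtain n0 where n0: "(1/2::real)^n0 < d" using real_arch_pow_inv[OF d, of "1/2"] by auto
  show ?thesis
  proof (rule Osgood_of_dyadic_growth[OF _ _ _ _ c])
    show "continuous_on {0..} (\<lambda>r. \<omega> r + r)" by (intro continuous_intros cont)
    show "0 < \<omega> r + r" if "0 < r" for r using nonneg[of r] that by simp
    show "0 \<le> \<omega> 0 + 0" using nonneg[of 0] by simp
    show "integral {0..(1/2)^k} (\<lambda>r. \<omega> r + r) \<le> ((1/2)^k)\<^sup>2 * (real k + 2)" if k: "n0 \<le> k" for k
    proof -
      define e :: real where "e = (1/2)^k"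
      have e: "0 < e" "e \<le> 1" by (auto simp: e_def power_le_one)
      have "e \<le> (1/2)^n0" unfolding e_def by (rule power_decreasing) (use k in auto)
      then have "e < d" using n0 by linarith
      then have *: "integral {0..e} \<omega> \<le> e\<^sup>2 * (1 + ln (1 / e))"
        using integral_le_of_mean_mult_exp[OF e small] e by simp
      have "ln (1 / e) = real k * ln 2" by (simp add: e_def power_one_over ln_realpow)
      also have "\<dots> \<le> real k * 1" using ln_2_less_1 by (intro mult_left_mono) auto
      finally have "e\<^sup>2 * (1 + ln (1 / e)) \<le> e\<^sup>2 * (1 + real k)"
        by (intro mult_left_mono) auto
      moreover have "integral {0..e} (\<lambda>r. \<omega> r + r) = integral {0..e} \<omega> + e\<^sup>2 / 2"
      proof -
        have "\<omega> integrable_on {0..e}"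
          by (intro integrable_continuous_real continuous_on_subset[OF cont]; simp)+
        moreover have "integral {0..e} (\<lambda>r. r) = e\<^sup>2 / 2"
          using ident_has_integral[of 0 e] e by (auto simp: integral_unique)
        ultimately show ?thesis by (simp add: integral_add integrable_continuous_real)
      qed
      ultimately show ?thesis
        unfolding e_def[symmetric] using * zero_le_power2[of e] by (simp only: distrib_left)
    qed
  qed
qed

theorem theorem1p6:
  fixes U :: "(real ^ 2) set" and f :: "real ^ 2 \<Rightarrow> real ^ 2" and \<omega> :: "real \<Rightarrow> real"
  assumes "open U"
    and "continuous_on U f"
    and "\<forall>x\<in>U. f x \<noteq> 0"
    and "modulus_of_continuity f U \<omega>"
    and "((\<lambda>\<epsilon>. (1 / \<epsilon>) * integral {0..\<epsilon>} \<omega> * exp ((1 / \<epsilon>\<^sup>2) * integral {0..\<epsilon>} \<omega>)) \<longlongrightarrow> 0)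
           (at_right 0)"
  shows "\<forall>p\<in>U. unique_local_integral_curve f U p"
proof -
  have cont: "continuous_on {0..} \<omega>" and nonneg: "\<And>t. 0 \<le> t \<Longrightarrow> 0 \<le> \<omega> t"
    and mod: "\<And>x y. x \<in> U \<Longrightarrow> y \<in> U \<Longrightarrow> dist (f x) (f y) \<le> \<omega> (dist x y)"
    using assms(4) by (auto simp: modulus_of_continuity_def)
  have "\<gamma>1 t = \<gamma>2 t"
    if "integral_curve_through f U t0 p I1 \<gamma>1" "integral_curve_through f U t0 p I2 \<gamma>2" "t \<in> I1 \<inter> I2"
    for p t0 I1 \<gamma>1 I2 \<gamma>2 t
  proof (rule integral_curves_agree_of_Osgood[where \<phi> = "\<lambda>r. \<omega> r + r", OF _ _ _ _ that])
    show "dist (f x) (f y) \<le> \<omega> (dist x y) + dist x y" if "x \<in> U" "y \<in> U" for x y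
      using mod[OF that] by (simp add: add_increasing2)
    show "continuous_on {0<..} (\<lambda>r. \<omega> r + r)"
      by (intro continuous_intros continuous_on_subset[OF cont]) auto
    show "0 < \<omega> r + r" if "0 < r" for r using nonneg[of r] that by simp
    show "\<exists>r\<in>{0<..<c}. K < integral {r..c} (\<lambda>r. 1 / (\<omega> r + r))" if "0 < c" for K c
      by (rule Osgood_of_mean_mult_exp[OF cont nonneg assms(5) that])
  qed
  then show ?thesis
    unfolding unique_local_integral_curve_def
    by (intro ballI allI conjI impI Peano_local_existence[OF assms(1,2)] exI[of _ 1]) auto
qed

end
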